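(* Let $\underline b<0<\overline b$ be real numbers and let $M=(M_t:0\le t\le\infty)$ be a continuous uniformly integrable martingale with $M_0=0$ a.s. Then $$\mathbb P\big(\overline M_\infty\ge\overline b,\ \underline M_\infty>\underline b\big)\ \ge\ \sup\Big\{0,\ \mathbb E\big[\underline G_{II}(K_1',K_2)\big],\ \mathbb E\big[\underline G_{III}(K_1,K_2)\big]\Big\},$$ where the supremum is taken over all $K_1,K_1',K_2$ with $\underline b<K_2<K_1<\overline b<K_1'$, and $\underline G_{II},\underline G_{III}$ are the random variables defined in the context.
   Context: $M_\infty=\lim_{t\to\infty}M_t$; $\overline M_\infty=\sup_{t\le\infty}M_t$, $\underline M_\infty=\inf_{t\le\infty}M_t$; $H_x=\inf\{t\in[0,\infty]:M_t=x\}$ with $\inf\emptyset=\infty$; $a^+=\max\{a,0\}$. Write $$A=\{H_{\overline b}<H_{\underline b},\ H_{\overline b}<\infty\},\quad A'=\{H_{\overline b}<H_{\underline b},\ \underline M_\infty\le\underline b\},\quad C=\{H_{\underline b}<H_{\overline b},\ H_{\underline b}<\infty\}$$ (so $A'$ is the event that $\overline b$ is hit before $\underline b$ and $\underline b$ is then hit). For $K_1\ge\overline b>K_2\ge\underline b$, $\underline G_{II}(K_1,K_2)$ is defined by $$1-\underline G_{II}(K_1,K_2)=\alpha_2(K_2-M_\infty)^++(1-\alpha_4)\mathbf 1_{\{M_\infty<\overline b\}}-\alpha_2(M_\infty-\overline b)^++\alpha_1(M_\infty-K_1)^++\alpha_4$$ $$\qquad+(\alpha_2-\alpha_1)(M_\infty-\overline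 b)\mathbf 1_{A}+\alpha_1(M_\infty-\underline b)\mathbf 1_{A'}+\alpha_2(M_\infty-\underline b)\mathbf 1_{C},$$ with $\alpha_1=\frac1{K_1-\underline b}$, $\alpha_2=\frac{\overline b-\underline b}{(K_1-\underline b)(\overline b-K_2)}$, $\alpha_4=\frac{K_1-\overline b}{K_1-\underline b}$. For $\underline b<K_2<K_1<\overline b$, $\underline G_{III}(K_1,K_2)$ is defined by $$1-\underline G_{III}(K_1,K_2)=\alpha_2(K_2-M_\infty)^++\alpha_1(K_1-M_\infty)^++\mathbf 1_{\{M_\infty<\overline b\}}-\alpha_1(M_\infty-\overline b)^+$$ $$\qquad+\alpha_1(M_\infty-\overline b)\mathbf 1_{A}+\alpha_2(M_\infty-\underline b)\mathbf 1_{A'}+(\alpha_1+\alpha_2)(M_\infty-\underline b)\mathbf 1_{C},$$ with (here) $\alpha_1=\frac1{\overline b-K_1}$, $\alpha_2=\frac1{K_2-\underline b}$. *)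

theory Defs
  imports "HOL-Probability.Probability"
begin

text \<open>
  Time runs through \<open>[0, \<infinity>]\<close>, represented by the type \<^typ>\<open>ennreal\<close>; in particular the terminal
  value \<open>M \<infinity>\<close> is part of the process.
\<close>

definition martingale ::
    "'a measure \<Rightarrow> (ennreal \<Rightarrow> 'a measure) \<Rightarrow> (ennreal \<Rightarrow> 'a \<Rightarrow> real) \<Rightarrow> bool" where
  "martingale P F M \<longleftrightarrow>
     filtration (space P) F \<and> (\<forall>t. subalgebra P (F t)) \<and>
     (\<forall>t. M t \<in> borel_measurable (F t)) \<and>
     (\<forall>t. integrable P (M t)) \<and>
     (\<forall>s t. s \<le> t \<longrightarrow> (AE \<omega> in P. real_cond_exp P (F s) (M t) \<omega> = M s \<omega>))"

definition uniformly_integrable :: "'a measure \<Rightarrow> ('i \<Rightarrow> 'a \<Rightarrow> real) \<Rightarrow> bool" where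
  "uniformly_integrable P X \<longleftrightarrow>
     (\<forall>i. X i \<in> borel_measurable P) \<and>
     ((\<lambda>c::real. SUP i. \<integral>\<^sup>+ \<omega>. ennreal \<bar>X i \<omega>\<bar> * indicator {\<omega>. c \<le> \<bar>X i \<omega>\<bar>} \<omega> \<partial>P) \<longlongrightarrow> 0) at_top"

text \<open>
  Every path is continuous on \<open>[0, \<infinity>)\<close>. The identity \<open>M \<infinity> = lim\<^sub>t\<^sub>\<rightarrow>\<^sub>\<infinity> M t\<close> is only required
  almost surely, since martingale convergence gives no more than that.
\<close>

definition continuous_paths :: "'a measure \<Rightarrow> (ennreal \<Rightarrow> 'a \<Rightarrow> real) \<Rightarrow> bool" where
  "continuous_paths P M \<longleftrightarrow>
     (\<forall>\<omega>\<in>space P. continuous_on {..<\<infinity>} (\<lambda>t. M t \<omega>)) \<and>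
     (AE \<omega> in P. ((\<lambda>t::real. M (ennreal t) \<omega>) \<longlongrightarrow> M \<infinity> \<omega>) at_top)"

definition sup_path :: "(ennreal \<Rightarrow> 'a \<Rightarrow> real) \<Rightarrow> 'a \<Rightarrow> ereal" where
  "sup_path M \<omega> = (SUP t. ereal (M t \<omega>))"

definition inf_path :: "(ennreal \<Rightarrow> 'a \<Rightarrow> real) \<Rightarrow> 'a \<Rightarrow> ereal" where
  "inf_path M \<omega> = (INF t. ereal (M t \<omega>))"

text \<open>In \<^typ>\<open>ennreal\<close> the infimum of the empty set is \<open>\<infinity>\<close>, as the convention for hitting times demands.\<close>

definition hit :: "(ennreal \<Rightarrow> 'a \<Rightarrow> real) \<Rightarrow> real \<Rightarrow> 'a \<Rightarrow> ennreal" where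
  "hit M x \<omega> = Inf {t. M t \<omega> = x}"

definition event_A :: "(ennreal \<Rightarrow> 'a \<Rightarrow> real) \<Rightarrow> real \<Rightarrow> real \<Rightarrow> 'a set" where
  "event_A M lb ub = {\<omega>. hit M ub \<omega> < hit M lb \<omega> \<and> hit M ub \<omega> < \<infinity>}"

definition event_A' :: "(ennreal \<Rightarrow> 'a \<Rightarrow> real) \<Rightarrow> real \<Rightarrow> real \<Rightarrow> 'a set" where
  "event_A' M lb ub = {\<omega>. hit M ub \<omega> < hit M lb \<omega> \<and> inf_path M \<omega> \<le> ereal lb}"

definition event_C :: "(ennreal \<Rightarrow> 'a \<Rightarrow> real) \<Rightarrow> real \<Rightarrow> real \<Rightarrow> 'a set" where
  "event_C M lb ub = {\<omega>. hit M lb \<omega> < hit M ub \<omega> \<and> hit M lb \<omega> < \<infinity>}"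

definition pos_part :: "real \<Rightarrow> real" where
  "pos_part a = max a 0"

text \<open>Intended for \<open>K1 \<ge> ub > K2 \<ge> lb\<close>.\<close>

definition G_II :: "(ennreal \<Rightarrow> 'a \<Rightarrow> real) \<Rightarrow> real \<Rightarrow> real \<Rightarrow> real \<Rightarrow> real \<Rightarrow> 'a \<Rightarrow> real" where
  "G_II M lb ub K1 K2 \<omega> =
     (let \<alpha>1 = 1 / (K1 - lb);
          \<alpha>2 = (ub - lb) / ((K1 - lb) * (ub - K2));
          \<alpha>4 = (K1 - ub) / (K1 - lb);
          m = M \<infinity> \<omega>
      in 1 - (\<alpha>2 * pos_part (K2 - m)
              + (1 - \<alpha>4) * indicator {\<omega>. M \<infinity> \<omega> < ub} \<omega>
              - \<alpha>2 * pos_part (m - ub)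
              + \<alpha>1 * pos_part (m - K1)
              + \<alpha>4
              + (\<alpha>2 - \<alpha>1) * (m - ub) * indicator (event_A M lb ub) \<omega>
              + \<alpha>1 * (m - lb) * indicator (event_A' M lb ub) \<omega>
              + \<alpha>2 * (m - lb) * indicator (event_C M lb ub) \<omega>))"

text \<open>Intended for \<open>lb < K2 < K1 < ub\<close>.\<close>

definition G_III :: "(ennreal \<Rightarrow> 'a \<Rightarrow> real) \<Rightarrow> real \<Rightarrow> real \<Rightarrow> real \<Rightarrow> real \<Rightarrow> 'a \<Rightarrow> real" where
  "G_III M lb ub K1 K2 \<omega> =
     (let \<alpha>1 = 1 / (ub - K1);
          \<alpha>2 = 1 / (K2 - lb);
          m = M \<infinity> \<omega>
      in 1 - (\<alpha>2 * pos_part (K2 - m)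
              + \<alpha>1 * pos_part (K1 - m)
              + indicator {\<omega>. M \<infinity> \<omega> < ub} \<omega>
              - \<alpha>1 * pos_part (m - ub)
              + \<alpha>1 * (m - ub) * indicator (event_A M lb ub) \<omega>
              + \<alpha>2 * (m - lb) * indicator (event_A' M lb ub) \<omega>
              + (\<alpha>1 + \<alpha>2) * (m - lb) * indicator (event_C M lb ub) \<omega>))"

end

theory Submission
  imports Defs
begin

text \<open>
  The inequality holds pathwise: almost surely both random variables are dominated by the
  indicator of the event, so that no optional stopping is needed. A path with \<open>M 0 = 0\<close> that
  converges to \<open>M \<infinity>\<close> is continuous on the compact interval \<open>[0, \<infinity>]\<close>; it therefore attains its
  extrema and satisfies the intermediate value theorem. Hence it hits \<open>ub\<close> first, or hits \<open>lb\<close>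
  first, or stays strictly inside \<open>(lb, ub)\<close> before \<open>\<infinity>\<close>; in each case, the domination is an
  inequality between piecewise linear functions of \<open>M \<infinity>\<close>.
\<close>

section \<open>Continuity up to time infinity\<close>

lemma continuous_on_UNIV_ennrealI:
  fixes f :: "ennreal \<Rightarrow> 'b::topological_space"
  assumes cont: "continuous_on {..<\<infinity>} f"
    and lim: "((\<lambda>t::real. f (ennreal t)) \<longlongrightarrow> f \<infinity>) at_top"
  shows "continuous_on UNIV f"
proof (intro continuous_at_imp_continuous_on ballI)
  fix x :: ennreal
  show "isCont f x"
  proof (cases "x = \<infinity>")
    case False
    then have "x \<in> {..<\<infinity>}" by (simp add: less_top)
    then show ?thesis using cont continuous_on_eq_continuous_at[OF open_lessThan] by blast
  next
    case True
    have "(f \<longlongrightarrow> f \<infinity>) (at \<infinity>)"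
    proof (rule topological_tendstoI)
      fix S :: "'b set" assume "open S" "f \<infinity> \<in> S"
      then have "eventually (\<lambda>t. f (ennreal t) \<in> S) at_top"
        using lim topological_tendstoD by blast
      then obtain T where T: "f (ennreal t) \<in> S" if "t \<ge> T" for t
        by (auto simp: eventually_at_top_linorder)
      have "eventually (\<lambda>x. x \<in> {ennreal T<..}) (nhds \<infinity>)"
        by (intro eventually_nhds_in_open) auto
      then show "eventually (\<lambda>x. f x \<in> S) (at \<infinity>)"
        unfolding eventually_at_filter
      proof eventually_elim
        case (elim x)
        show ?case
        proof (intro impI)
          assume "x \<noteq> \<infinity>"
          then obtain r where r: "x = ennreal r" "r \<ge> 0" by (cases x) auto
          \<comment> \<open>If \<open>T\<close> is negative, then \<open>ennreal T\<close> is 0 and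
            the bound comes from \<open>r \<ge> 0\<close> instead.\<close>
          then have "T \<le> r" using elim by (cases "T \<ge> 0") (auto simp: ennreal_less_iff)
          then show "f x \<in> S" using T r by simp
        qed
      qed
    qed
    then show ?thesis using True by (simp add: isCont_def)
  qed
qed

section \<open>Measurability of the extrema of a path\<close>

text \<open>A value above the countable supremum would, by continuity, be approached on a nonempty
  open set of finite times, which meets \<open>D\<close>. The time \<infinity> is inserted by hand
  because continuity is assumed only before it. The identity thus holds on every path, not just
  almost surely, which matters since \<open>P\<close> may be incomplete.\<close>

lemma SUP_dense_subset:
  fixes f :: "ennreal \<Rightarrow> real"
  assumes cont: "continuous_on {..<\<infinity>} f"
    and dense: "\<And>X. open X \<Longrightarrow> X \<noteq> {} \<Longrightarrow> \<exists>d\<in>D. d \<in> X"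
  shows "(SUP t. ereal (f t)) = (SUP t\<in>insert \<infinity> D. ereal (f t))"
proof (rule antisym)
  show "(SUP t. ereal (f t)) \<le> (SUP t\<in>insert \<infinity> D. ereal (f t))"
  proof (rule SUP_least)
    fix t
    show "ereal (f t) \<le> (SUP t\<in>insert \<infinity> D. ereal (f t))"
    proof (cases "t = \<infinity>")
      case True
      then show ?thesis by (intro SUP_upper) auto
    next
      case False
      show ?thesis
      proof (rule ccontr)
        assume "\<not> ereal (f t) \<le> (SUP t\<in>insert \<infinity> D. ereal (f t))"
        then have *: "(SUP t\<in>insert \<infinity> D. ereal (f t)) < ereal (f t)"
          by (simp only: not_le)
        then obtain y where y: "(SUP t\<in>insert \<infinity> D. ereal (f t)) < ereal y" "y < f t"
          using ereal_dense2[OF *] by auto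
        let ?X = "f -` {y<..} \<inter> {..<\<infinity>}"
        have "open ?X" using cont by (auto simp: continuous_on_open_vimage)
        moreover have "t \<in> ?X" using False y by (simp add: less_top)
        ultimately obtain d where d: "d \<in> D" "y < f d" using dense[of ?X] by auto
        have "ereal (f d) \<le> (SUP t\<in>insert \<infinity> D. ereal (f t))" using d by (intro SUP_upper) auto
        also have "\<dots> < ereal y" by (rule y)
        finally show False using d by simp
      qed
    qed
  qed
qed (rule SUP_subset_mono, auto)

lemma borel_measurable_sup_path:
  assumes cont: "\<And>\<omega>. \<omega> \<in> space P \<Longrightarrow> continuous_on {..<\<infinity>} (\<lambda>t. M t \<omega>)"
    and meas: "\<And>t. M t \<in> borel_measurable P"
  shows "sup_path M \<in> borel_measurable P"
proof -
  obtain D :: "ennreal set" where D: "countable D" "\<And>X. open X \<Longrightarrow> X \<noteq> {} \<Longrightarrow> \<exists>d\<in>D. d \<in> X"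
    using countable_dense_exists by metis
  have "(\<lambda>\<omega>. SUP t\<in>insert \<infinity> D. ereal (M t \<omega>)) \<in> borel_measurable P"
    using D(1) meas by (intro borel_measurable_SUP) auto
  moreover have "sup_path M \<omega> = (SUP t\<in>insert \<infinity> D. ereal (M t \<omega>))" if "\<omega> \<in> space P" for \<omega>
    unfolding sup_path_def using SUP_dense_subset[OF cont[OF that] D(2)] .
  ultimately show ?thesis by (subst measurable_cong) auto
qed

lemma inf_path_eq_uminus_sup_path: "inf_path M \<omega> = - sup_path (\<lambda>t \<omega>. - M t \<omega>) \<omega>"
  using ereal_INF_uminus_eq[of "\<lambda>t. - ereal (M t \<omega>)" UNIV] by (simp add: inf_path_def sup_path_def)

lemma borel_measurable_inf_path:
  assumes cont: "\<And>\<omega>. \<omega> \<in> space P \<Longrightarrow> continuous_on {..<\<infinity>} (\<lambda>t. M t \<omega>)"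
    and meas: "\<And>t. M t \<in> borel_measurable P"
  shows "inf_path M \<in> borel_measurable P"
proof -
  have "sup_path (\<lambda>t \<omega>. - M t \<omega>) \<in> borel_measurable P"
    using assms by (intro borel_measurable_sup_path continuous_on_minus) auto
  then show ?thesis
    unfolding inf_path_eq_uminus_sup_path[abs_def] by simp
qed

section \<open>Hitting times and classification of paths\<close>

lemma hit_less_imp:
  assumes "hit M x \<omega> < y"
  shows "\<exists>t. M t \<omega> = x"
  using assms by (auto simp: hit_def Inf_less_iff)

lemma hit_attained:
  assumes "hit M x \<omega> < \<infinity>" and cont: "continuous_on UNIV (\<lambda>t. M t \<omega>)"
  shows "M (hit M x \<omega>) \<omega> = x"
proof -
  have ne: "{t. M t \<omega> = x} \<noteq> {}" using hit_less_imp[OF assms(1)] by auto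
  have "closed {t. M t \<omega> = x}"
    using cont by (intro closed_Collect_eq continuous_on_const)
  then have "Inf {t. M t \<omega> = x} \<in> {t. M t \<omega> = x}"
    using ne by (intro closed_contains_Inf_cl) auto
  then show ?thesis by (simp add: hit_def)
qed

text \<open>The value \<infinity> does not distinguish a level that is never reached from one
  reached only at time \<infinity>. This ambiguity is the source of the case \<open>ends_ub\<close>
  below.\<close>

lemma hit_eq_infinity_iff: "hit M x \<omega> = \<infinity> \<longleftrightarrow> (\<forall>t. M t \<omega> = x \<longrightarrow> t = \<infinity>)"
  by (auto simp: hit_def)

text \<open>The cases come from comparing the two hitting times. If these agree they are
  \<infinity>, since at a common finite time the path would equal both \<open>lb\<close> and
  \<open>ub\<close>. The path then avoids both levels at finite times; if it ends at
  \<open>ub\<close>, the target event occurs although none of the three events does.\<close>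

lemma path_cases:
  assumes cont: "continuous_on UNIV (\<lambda>t. M t \<omega>)" and "M 0 \<omega> = 0" "lb < 0" "0 < ub"
  obtains
    (ub_only) "\<omega> \<in> event_A M lb ub" "\<omega> \<notin> event_A' M lb ub" "\<omega> \<notin> event_C M lb ub"
      "sup_path M \<omega> \<ge> ub" "inf_path M \<omega> > lb"
  | (ub_lb) "\<omega> \<in> event_A M lb ub" "\<omega> \<in> event_A' M lb ub" "\<omega> \<notin> event_C M lb ub"
  | (lb_first) "\<omega> \<notin> event_A M lb ub" "\<omega> \<notin> event_A' M lb ub" "\<omega> \<in> event_C M lb ub"
  | (inside) "\<omega> \<notin> event_A M lb ub" "\<omega> \<notin> event_A' M lb ub" "\<omega> \<notin> event_C M lb ub"
      "M \<infinity> \<omega> < ub"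
  | (ends_ub) "\<omega> \<notin> event_A M lb ub" "\<omega> \<notin> event_A' M lb ub" "\<omega> \<notin> event_C M lb ub"
      "M \<infinity> \<omega> = ub" "sup_path M \<omega> \<ge> ub" "inf_path M \<omega> > lb"
proof -
  consider "hit M ub \<omega> < hit M lb \<omega>" | "hit M lb \<omega> < hit M ub \<omega>" | "hit M ub \<omega> = hit M lb \<omega>"
    by fastforce
  then show ?thesis
  proof cases
    case 1
    then have "hit M ub \<omega> < \<infinity>" using less_le_trans[OF 1 top_greatest] by simp
    then have A: "\<omega> \<in> event_A M lb ub" "\<omega> \<notin> event_C M lb ub"
      using 1 by (auto simp: event_A_def event_C_def)
    obtain t where "M t \<omega> = ub" using hit_less_imp[OF 1] by blast
    then have "sup_path M \<omega> \<ge> ub" by (auto simp: sup_path_def intro: SUP_upper2)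
    then show ?thesis
      using A 1 ub_only ub_lb by (cases "inf_path M \<omega> \<le> ereal lb") (auto simp: event_A'_def)
  next
    case 2
    then have "hit M lb \<omega> < \<infinity>" using less_le_trans[OF 2 top_greatest] by simp
    moreover have "\<not> hit M ub \<omega> < hit M lb \<omega>" using 2 by simp
    ultimately show ?thesis
      using 2 lb_first by (simp add: event_A_def event_A'_def event_C_def)
  next
    case 3
    have "hit M lb \<omega> = \<infinity>"
    proof (rule ccontr)
      assume "hit M lb \<omega> \<noteq> \<infinity>"
      then have "hit M lb \<omega> < \<infinity>" by (simp add: less_top)
      then show False using hit_attained[of M lb \<omega>] hit_attained[of M ub \<omega>] cont 3 assms by simp
    qed
    then have lb: "M t \<omega> \<noteq> lb" and ub: "M t \<omega> \<noteq> ub" if "t \<noteq> \<infinity>" for t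
      using 3 that by (metis hit_eq_infinity_iff)+
    \<comment> \<open>An end value above \<open>ub\<close> would force a crossing of
      \<open>ub\<close>, necessarily at a finite time.\<close>
    have le: "M \<infinity> \<omega> \<le> ub"
    proof (rule ccontr)
      assume "\<not> ?thesis"
      then obtain s where "M s \<omega> = ub"
        using IVT'[of "\<lambda>t. M t \<omega>" 0 ub \<infinity>] assms continuous_on_subset[OF cont] by auto
      with ub \<open>\<not> ?thesis\<close> show False by (cases "s = \<infinity>") auto
    qed
    have notin: "\<omega> \<notin> event_A M lb ub" "\<omega> \<notin> event_A' M lb ub" "\<omega> \<notin> event_C M lb ub"
      using 3 by (auto simp: event_A_def event_A'_def event_C_def)
    show ?thesis
    proof (cases "M \<infinity> \<omega> < ub")
      case True
      then show ?thesis using inside notin by blast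
    next
      case False
      with le have eq: "M \<infinity> \<omega> = ub" by simp
      have gt: "M t \<omega> > lb" for t
      proof (rule ccontr)
        assume "\<not> ?thesis"
        then obtain s where "M s \<omega> = lb"
          using IVT2'[of "\<lambda>t. M t \<omega>" t lb 0] assms continuous_on_subset[OF cont] by auto
        with lb[of s] eq assms show False by (cases "s = \<infinity>") auto
      qed
      \<comment> \<open>The bound \<open>gt\<close> alone gives only a weak inequality for the
        infimum; compactness of [0, \<infinity>] makes it an attained minimum and keeps it
        strict.\<close>
      obtain s where "\<And>t. M s \<omega> \<le> M t \<omega>"
        using continuous_attains_inf[OF compact_UNIV _ cont] by auto
      then have "ereal (M s \<omega>) \<le> inf_path M \<omega>" by (auto simp: inf_path_def intro: INF_greatest)
      with gt[of s] have "inf_path M \<omega> > lb" by (meson ereal_less_eq(3) less_le_trans less_ereal.simps(1))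
      moreover have "sup_path M \<omega> \<ge> ub" using eq by (auto simp: sup_path_def intro: SUP_upper2)
      ultimately show ?thesis using ends_ub notin eq by blast
    qed
  qed
qed

section \<open>Pathwise domination by the indicator\<close>

text \<open>It suffices that \<open>1 - G_II\<close> is nonnegative in the cases
  \<open>ub_only\<close> and \<open>ends_ub\<close>, and at least 1 in the others. In
  \<open>ub_only\<close> the slopes cancel to \<open>a * (K1 - m)\<close> for \<open>m < K2\<close>
  and for \<open>ub \<le> m < K1\<close>, and to 0 from \<open>K1\<close> on. The term of
  \<open>event_A'\<close> adds \<open>a * (m - lb)\<close>, which lifts the first value to exactly
  \<open>a * (K1 - lb) = 1\<close>.\<close>

lemma G_II_le_indicator:
  assumes cont: "continuous_on UNIV (\<lambda>t. M t \<omega>)" and M0: "M 0 \<omega> = 0"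
    and "lb < 0" "0 < ub" "lb \<le> K2" "K2 < ub" "ub \<le> K1"
  shows "G_II M lb ub K1 K2 \<omega> \<le> indicator {\<omega>. sup_path M \<omega> \<ge> ereal ub \<and> inf_path M \<omega> > ereal lb} \<omega>"
proof -
  define m where "m = M \<infinity> \<omega>"
  define a where "a = 1 / (K1 - lb)"
  define b where "b = (ub - lb) / ((K1 - lb) * (ub - K2))"
  have a: "a > 0" "a * (K1 - lb) = 1" using assms by (auto simp: a_def)
  have b: "b > 0" "b * (ub - K2) = a * (ub - lb)"
    using assms by (auto simp: a_def b_def divide_simps)
  \<comment> \<open>This makes the weight \<open>b - a\<close> of \<open>event_A\<close>
    nonnegative.\<close>
  have ab: "a \<le> b"
  proof -
    have "a * (ub - K2) \<le> a * (ub - lb)" using a assms by (intro mult_left_mono) auto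
    then have "a * (ub - K2) \<le> b * (ub - K2)" using b by simp
    then show ?thesis using assms by simp
  qed
  have c: "(K1 - ub) / (K1 - lb) = a * (K1 - ub)" by (simp add: a_def)
  have G: "G_II M lb ub K1 K2 \<omega> =
      1 - (b * pos_part (K2 - m) + (1 - a * (K1 - ub)) * (if m < ub then 1 else 0)
        - b * pos_part (m - ub) + a * pos_part (m - K1) + a * (K1 - ub)
        + (b - a) * (m - ub) * indicator (event_A M lb ub) \<omega>
        + a * (m - lb) * indicator (event_A' M lb ub) \<omega>
        + b * (m - lb) * indicator (event_C M lb ub) \<omega>)"
    unfolding G_II_def Let_def m_def[symmetric] b_def[symmetric] c
    by (simp add: a_def[symmetric] indicator_def m_def)
  have mono: "x \<le> y \<Longrightarrow> a * x \<le> a * y" "x \<le> y \<Longrightarrow> b * x \<le> b * y" "x \<le> y \<Longrightarrow> (b - a) * x \<le> (b - a) * y" for x y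
    using a b ab by (auto intro: mult_left_mono)
  \<comment> \<open>Needed when \<open>lb\<close> is hit first and \<open>m \<ge> ub\<close>: the
    \<open>b\<close> terms then collapse to the constant \<open>b * (ub - lb)\<close>.\<close>
  have ab_diff: "1 - a * (K1 - ub) \<le> b * (ub - lb)"
  proof -
    have "1 - a * (K1 - ub) = a * (ub - lb)" using a(2) by (simp add: algebra_simps)
    also have "\<dots> \<le> b * (ub - lb)" using ab assms by (intro mult_right_mono) auto
    finally show ?thesis .
  qed
  note simps = G pos_part_def max_def algebra_simps
  \<comment> \<open>Between these breakpoints \<open>G_II\<close> is affine in \<open>m\<close>; the
    instances of \<open>mono\<close> supply the products that linear arithmetic cannot find.\<close>
  consider "m < K2" | "K2 \<le> m" "m < ub" | "ub \<le> m" "m < K1" | "K1 \<le> m" by linarith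
  note regions = this
  from cont M0 \<open>lb < 0\<close> \<open>0 < ub\<close> show ?thesis
  proof (cases rule: path_cases)
    case ub_only
    \<comment> \<open>On \<open>K2 \<le> m < ub\<close>, \<open>1 - G_II\<close> is
      \<open>1 + (b - a) * (m - ub)\<close>, smallest at \<open>m = K2\<close> with value
      \<open>a * (K1 - K2)\<close>.\<close>
    show ?thesis using regions
      by cases (use ub_only a b assms mono(1)[of m K1] mono(3)[of K2 m] mono(1)[of "K2 - lb" "K1 - lb", unfolded a(2)] in \<open>auto simp: simps\<close>)
  next
    case ub_lb
    \<comment> \<open>On \<open>K2 \<le> m < ub\<close>, the relation between \<open>a\<close> and
      \<open>b\<close> turns \<open>1 - G_II\<close> into \<open>1 + b * (m - K2)\<close>.\<close>
    have "G_II M lb ub K1 K2 \<omega> \<le> 0" using regions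
      by cases (use ub_lb a b assms mono(1)[of K1 m] mono(2)[of K2 m] in \<open>auto simp: simps\<close>)
    then show ?thesis by (auto simp: indicator_def)
  next
    case lb_first
    have "G_II M lb ub K1 K2 \<omega> \<le> 0"
    proof (cases "m < ub")
      case True
      then show ?thesis
        using lb_first a b assms mono(2)[of lb m] mono(2)[of lb K2]
        by (cases "m < K2") (auto simp: simps)
    next
      case False
      then have "G_II M lb ub K1 K2 \<omega> =
          1 - (a * pos_part (m - K1) + a * (K1 - ub) + (b * (m - lb) - b * (m - ub)))"
        using lb_first assms by (simp add: G pos_part_def)
      moreover have "b * (m - lb) - b * (m - ub) = b * (ub - lb)" by (simp add: algebra_simps)
      moreover have "0 \<le> a * pos_part (m - K1)" using a by (simp add: pos_part_def)
      ultimately show ?thesis using ab_diff by linarith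
    qed
    then show ?thesis by (auto simp: indicator_def)
  next
    case inside
    then have "G_II M lb ub K1 K2 \<omega> \<le> 0" using assms mono(2)[of m K2] by (auto simp: simps m_def)
    then show ?thesis by (auto simp: indicator_def)
  next
    case ends_ub
    then show ?thesis using a assms mono(1)[of ub K1] by (auto simp: simps m_def)
  qed
qed

text \<open>The same scheme with \<open>a\<close> and \<open>b\<close> normalised independently. In
  \<open>ub_only\<close>, \<open>1 - G_III\<close> is \<open>b * (K2 - m)\<close> below
  \<open>K2\<close>, \<open>1 - a * (ub - m)\<close> on \<open>K1 \<le> m < ub\<close>, and 0
  elsewhere. After a later visit to \<open>lb\<close> the added \<open>b * (m - lb)\<close> raises
  it to at least 1. In \<open>ends_ub\<close> the bound is an equality.\<close>

lemma G_III_le_indicator: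
  assumes cont: "continuous_on UNIV (\<lambda>t. M t \<omega>)" and M0: "M 0 \<omega> = 0"
    and "lb < 0" "0 < ub" "lb < K2" "K2 \<le> K1" "K1 < ub"
  shows "G_III M lb ub K1 K2 \<omega> \<le> indicator {\<omega>. sup_path M \<omega> \<ge> ereal ub \<and> inf_path M \<omega> > ereal lb} \<omega>"
proof -
  define m where "m = M \<infinity> \<omega>"
  define a where "a = 1 / (ub - K1)"
  define b where "b = 1 / (K2 - lb)"
  have a: "a > 0" "a * (ub - K1) = 1" using assms by (auto simp: a_def)
  have b: "b > 0" "b * (K2 - lb) = 1" using assms by (auto simp: b_def)
  have G: "G_III M lb ub K1 K2 \<omega> =
      1 - (b * pos_part (K2 - m) + a * pos_part (K1 - m) + (if m < ub then 1 else 0)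
        - a * pos_part (m - ub)
        + a * (m - ub) * indicator (event_A M lb ub) \<omega>
        + b * (m - lb) * indicator (event_A' M lb ub) \<omega>
        + (a + b) * (m - lb) * indicator (event_C M lb ub) \<omega>)"
    unfolding G_III_def Let_def m_def[symmetric] b_def[symmetric] a_def[symmetric]
    by (simp add: indicator_def m_def)
  have mono: "x \<le> y \<Longrightarrow> a * x \<le> a * y" "x \<le> y \<Longrightarrow> b * x \<le> b * y" for x y
    using a b by (auto intro: mult_left_mono)
  \<comment> \<open>The constant 1 separates both sides: for \<open>m\<close> from \<open>K1\<close>
    on, the loss through \<open>event_A\<close> is at most 1 and the gain through
    \<open>event_A'\<close> at least 1.\<close>
  have above: "a * (ub - m) \<le> b * (m - lb)" if "K1 \<le> m"
  proof -
    have "a * (ub - m) \<le> 1" using mono(1)[of "ub - m" "ub - K1", unfolded a(2)] that by simp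
    also have "1 \<le> b * (m - lb)"
      using mono(2)[of "K2 - lb" "m - lb", unfolded b(2)] that assms by simp
    finally show ?thesis .
  qed
  have lb_le: "a * lb + b * lb \<le> a * m + b * m" if "lb \<le> m"
    using that mono by (intro add_mono) auto
  note simps = G pos_part_def max_def algebra_simps
  consider "m < K2" | "K2 \<le> m" "m < K1" | "K1 \<le> m" "m < ub" | "ub \<le> m" by linarith
  note regions = this
  from cont M0 \<open>lb < 0\<close> \<open>0 < ub\<close> show ?thesis
  proof (cases rule: path_cases)
    case ub_only
    show ?thesis using regions
      by cases (use ub_only a b assms mono(1)[of "ub - m" "ub - K1", unfolded a(2)] mono(2)[of m K2] in \<open>auto simp: simps\<close>)
  next
    case ub_lb
    have "G_III M lb ub K1 K2 \<omega> \<le> 0" using regions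
      by cases (use ub_lb a b assms above mono(2)[of K2 m] in \<open>auto simp: simps\<close>)
    then show ?thesis by (auto simp: indicator_def)
  next
    case lb_first
    have "G_III M lb ub K1 K2 \<omega> \<le> 0" using regions
      by cases (use lb_first a b assms mono(1)[of lb K1] mono(1)[of lb ub] mono(2)[of K2 m] lb_le in \<open>auto simp: simps\<close>)
    then show ?thesis by (auto simp: indicator_def)
  next
    case inside
    then have "G_III M lb ub K1 K2 \<omega> \<le> 0"
      using mono(2)[of m K2] mono(1)[of m K1] by (auto simp: simps m_def)
    then show ?thesis by (auto simp: indicator_def)
  next
    case ends_ub
    then show ?thesis using assms by (auto simp: simps m_def)
  qed
qed

section \<open>From paths to expectations\<close>

text \<open>If \<open>X\<close> is not integrable, its integral is \<open>0\<close> by convention and the bound holds as well.\<close>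

lemma (in prob_space) integral_le_measure:
  assumes "B \<in> events" and "AE \<omega> in M. X \<omega> \<le> indicator B \<omega>"
  shows "integral\<^sup>L M X \<le> measure M B"
proof (cases "integrable M X")
  case True
  then have "integral\<^sup>L M X \<le> integral\<^sup>L M (indicator B :: 'a \<Rightarrow> real)"
    using assms by (intro integral_mono_AE) (auto simp: emeasure_eq_measure)
  then show ?thesis using assms(1) by simp
next
  case False
  then show ?thesis by (simp add: not_integrable_integral_eq)
qed

theorem proposition2p3:
  fixes P :: "'a measure" and F :: "ennreal \<Rightarrow> 'a measure"
    and M :: "ennreal \<Rightarrow> 'a \<Rightarrow> real" and lb ub :: real
  assumes "prob_space P"
    and "lb < 0" and "0 < ub"
    and "martingale P F M"
    and "continuous_paths P M"
    and "uniformly_integrable P M"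
    and "AE \<omega> in P. M 0 \<omega> = 0"
  shows "ereal (measure P {\<omega> \<in> space P. sup_path M \<omega> \<ge> ereal ub \<and> inf_path M \<omega> > ereal lb})
    \<ge> (SUP (K1, K1', K2) \<in> {(K1, K1', K2). lb < K2 \<and> K2 < K1 \<and> K1 < ub \<and> ub < K1'}.
         Sup {0, ereal (integral\<^sup>L P (G_II M lb ub K1' K2)), ereal (integral\<^sup>L P (G_III M lb ub K1 K2))})"
proof -
  interpret prob_space P by fact
  let ?E = "{\<omega>. sup_path M \<omega> \<ge> ereal ub \<and> inf_path M \<omega> > ereal lb}"
  let ?B = "{\<omega> \<in> space P. sup_path M \<omega> \<ge> ereal ub \<and> inf_path M \<omega> > ereal lb}"
  have cont: "continuous_on {..<\<infinity>} (\<lambda>t. M t \<omega>)" if "\<omega> \<in> space P" for \<omega>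
    using assms(5) that by (simp add: continuous_paths_def)
  have lim: "AE \<omega> in P. ((\<lambda>t::real. M (ennreal t) \<omega>) \<longlongrightarrow> M \<infinity> \<omega>) at_top"
    using assms(5) by (simp add: continuous_paths_def)
  have meas: "M t \<in> borel_measurable P" for t
    using assms(6) by (simp add: uniformly_integrable_def)
  have [measurable]: "sup_path M \<in> borel_measurable P" "inf_path M \<in> borel_measurable P"
    using borel_measurable_sup_path[of P M] borel_measurable_inf_path[of P M] cont meas by auto
  have B: "?B \<in> events" by measurable
  have path: "AE \<omega> in P. \<omega> \<in> space P \<and> continuous_on UNIV (\<lambda>t. M t \<omega>) \<and> M 0 \<omega> = 0"
    using lim assms(7) AE_space
    by eventually_elim (auto intro: continuous_on_UNIV_ennrealI cont)
  \<comment> \<open>\<open>?E\<close> omits the restriction to \<open>space P\<close> so that the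
    pathwise lemmas apply verbatim; on \<open>space P\<close> its indicator agrees with that of
    \<open>?B\<close>.\<close>
  have bound: "integral\<^sup>L P X \<le> measure P ?B"
    if "\<And>\<omega>. continuous_on UNIV (\<lambda>t. M t \<omega>) \<Longrightarrow> M 0 \<omega> = 0 \<Longrightarrow> X \<omega> \<le> indicator ?E \<omega>" for X
  proof (rule integral_le_measure[OF B])
    show "AE \<omega> in P. X \<omega> \<le> indicator ?B \<omega>"
      using path by eventually_elim (use that in \<open>auto simp: indicator_def\<close>)
  qed
  show ?thesis
  proof (intro SUP_least, clarify)
    fix K1 K1' K2 assume K: "lb < K2" "K2 < K1" "K1 < ub" "ub < K1'"
    have "integral\<^sup>L P (G_II M lb ub K1' K2) \<le> measure P ?B"
      using K assms(2,3) by (intro bound G_II_le_indicator) auto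
    moreover have "integral\<^sup>L P (G_III M lb ub K1 K2) \<le> measure P ?B"
      using K assms(2,3) by (intro bound G_III_le_indicator) auto
    ultimately show "Sup {0, ereal (integral\<^sup>L P (G_II M lb ub K1' K2)), ereal (integral\<^sup>L P (G_III M lb ub K1 K2))}
        \<le> ereal (measure P ?B)"
      by (intro Sup_least) auto
  qed
qed

end
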